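(* Let $\beta \in S_n$ be an $n$-cycle and let $k$ be an integer with $0\le k\le n$. Then \[ c(\leq k, \beta) \leq n\binom{n}{k}(k-1)!-n\binom{n}{k}+n, \] with equality for $0 \leq k \leq 3$ and for $k=n$.
   Context: $S_n$ is the group of permutations of $[n]=\{1,\dots,n\}$; products are composed right to left. The Hamming distance between $\sigma,\tau\in S_n$ is $H(\sigma,\tau)=|\{a\in[n]:\sigma(a)\neq\tau(a)\}|$. For $\beta\in S_n$ and a nonnegative integer $k$, $c(\le k,\beta)$ denotes the number of $\alpha\in S_n$ with $H(\alpha\beta,\beta\alpha)\le k$. An $n$-cycle is a permutation of $[n]$ consisting of a single cycle of length $n$. The convention $(-1)!=1$ is used. *)

theory Defs
  imports Complex_Main "HOL-Combinatorics.Cycles"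
begin

definition hamming :: "nat \<Rightarrow> (nat \<Rightarrow> nat) \<Rightarrow> (nat \<Rightarrow> nat) \<Rightarrow> nat"
  where "hamming n \<sigma> \<tau> = card {a \<in> {1..n}. \<sigma> a \<noteq> \<tau> a}"

definition c_le :: "nat \<Rightarrow> nat \<Rightarrow> (nat \<Rightarrow> nat) \<Rightarrow> nat"
  where "c_le n k \<beta> = card {\<alpha>. \<alpha> permutes {1..n} \<and> hamming n (\<alpha> \<circ> \<beta>) (\<beta> \<circ> \<alpha>) \<le> k}"

text \<open>Since \<open>cycle_of_list []\<close> is the identity, the condition \<open>n \<ge> 1\<close> is needed: a cycle
  has positive length, so the identity of \<open>S\<^sub>0\<close> is not an \<open>n\<close>-cycle. For \<open>n = 1\<close> the identity
  is the only \<open>n\<close>-cycle.\<close>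

definition n_cycle :: "nat \<Rightarrow> (nat \<Rightarrow> nat) \<Rightarrow> bool"
  where "n_cycle n \<beta> \<longleftrightarrow>
    n \<ge> 1 \<and> (\<exists>cs. cycle cs \<and> set cs = {1..n} \<and> \<beta> = cycle_of_list cs)"

text \<open>\<open>fact_pred k\<close> is \<open>(k - 1)!\<close>, with the convention \<open>(-1)! = 1\<close>.\<close>

definition fact_pred :: "nat \<Rightarrow> nat"
  where "fact_pred k = (if k = 0 then 1 else fact (k - 1))"

end

theory Submission
  imports Defs "HOL-Combinatorics.Multiset_Permutations"
begin

text \<open>Conjugation turns \<open>\<beta>\<close> into the shift \<open>i \<mapsto> i + 1\<close> of the integers modulo \<open>n\<close>, and the
  Hamming distance becomes the number of breaks \<open>i\<close> with \<open>a (i + 1) \<noteq> a i + 1\<close>. If all breaks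
  of \<open>a\<close> lie in a set \<open>S\<close> of size \<open>k \<ge> 1\<close>, then \<open>a\<close> moves the \<open>k\<close> arcs into which \<open>S\<close> cuts
  the cycle as rigid blocks, so it is given by one of \<open>n\<close> rotations and one of \<open>(k - 1)!\<close>
  cyclic orders of the blocks. The \<open>n\<close> rotations have no breaks and are counted for every \<open>S\<close>;
  a union bound over the \<open>n choose k\<close> sets \<open>S\<close> for the remaining permutations gives the
  inequality. For \<open>k = 3\<close> it is sharp because exchanging two adjacent blocks produces breaks at
  all three points of \<open>S\<close>, so that the sets in the union are disjoint.\<close>

section \<open>Breaks, and the passage from an n-cycle to the shift\<close>

definition breaks :: "nat \<Rightarrow> (nat \<Rightarrow> nat) \<Rightarrow> nat set"
  where "breaks n a = {i \<in> {..<n}. a (Suc i mod n) \<noteq> Suc (a i) mod n}"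

text \<open>Inclusion rather than equality: the rotations then lie in every such set, and a
  permutation with few breaks belongs to the set of every larger \<open>S\<close>.\<close>

definition perms_breaking_in :: "nat \<Rightarrow> nat set \<Rightarrow> (nat \<Rightarrow> nat) set"
  where "perms_breaking_in n S = {a. a permutes {..<n} \<and> breaks n a \<subseteq> S}"

text \<open>The identity branch makes this a permutation in the sense of \<open>permutes\<close>.
  Since \<open>j = n\<close> is allowed, \<open>rot n (n - j)\<close> inverts \<open>rot n j\<close>
  for all \<open>j \<le> n\<close>.\<close>

definition rot :: "nat \<Rightarrow> nat \<Rightarrow> nat \<Rightarrow> nat"
  where "rot n j i = (if i < n then (i + j) mod n else i)"

lemma breaks_subset: "breaks n a \<subseteq> {..<n}"
  by (auto simp: breaks_def)

lemma finite_breaks [simp]: "finite (breaks n a)"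
  using breaks_subset finite_subset by blast

lemma finite_perms_breaking_in [simp]: "finite (perms_breaking_in n S)"
  using finite_permutations[of "{..<n}"]
  by (rule rev_finite_subset) (auto simp: perms_breaking_in_def)

lemma c_le_eq_card_breaks:
  assumes "n_cycle n \<beta>"
  shows "c_le n k \<beta> = card {a. a permutes {..<n} \<and> card (breaks n a) \<le> k}"
proof -
  obtain cs where n: "n \<ge> 1" and cs: "distinct cs" "set cs = {1..n}" "\<beta> = cycle_of_list cs"
    using assms by (auto simp: n_cycle_def)
  have len: "length cs = n"
    using distinct_card[OF cs(1)] cs(2) by simp
  define f where "f i = cs ! i" for i
  have f: "bij_betw f {..<n} {1..n}"
    unfolding f_def using bij_betw_nth[OF cs(1)] len cs(2) by auto
  have \<beta>_f: "\<beta> (f i) = f (Suc i mod n)" if "i < n" for i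
  proof -
    have "map \<beta> cs = rotate1 cs"
      using cyclic_rotation[OF cs(1), of 1] cs(3) by simp
    then have "map \<beta> cs ! i = rotate1 cs ! i" by simp
    then show ?thesis
      using that len by (simp add: f_def nth_rotate1)
  qed
  \<comment> \<open>Conjugation by \<open>f\<close>, extended by the identity outside
    \<open>{1..n}\<close>.\<close>
  define \<Phi> where "\<Phi> a x = (if x \<in> {1..n} then f (a (inv_into {..<n} f x)) else x)"
    for a :: "nat \<Rightarrow> nat" and x
  have \<Phi>: "bij_betw \<Phi> {a. a permutes {..<n}} {\<alpha>. \<alpha> permutes {1..n}}"
    using bij_betw_permutations[OF f] by (simp add: \<Phi>_def[abs_def])
  have f_in: "f i \<in> {1..n}" if "i < n" for i
    using f that by (auto simp: bij_betw_def)
  have \<Phi>_f: "\<Phi> a (f i) = f (a i)" if "i < n" for a i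
    using f_in[OF that] f that by (simp add: \<Phi>_def bij_betw_def inv_into_f_f)
  have ham: "hamming n (\<Phi> a \<circ> \<beta>) (\<beta> \<circ> \<Phi> a) = card (breaks n a)" if a: "a permutes {..<n}" for a
  proof -
    have ai: "a i < n" if "i < n" for i
      using permutes_in_image[OF a, of i] that by simp
    have inj: "f i = f j \<longleftrightarrow> i = j" if "i < n" "j < n" for i j
      using f that by (auto simp: bij_betw_def inj_on_def)
    \<comment> \<open>At \<open>f i\<close> the two products have the values
      \<open>f (a (Suc i mod n))\<close> and \<open>f (Suc (a i) mod n)\<close>, and
      \<open>f\<close> is injective on \<open>{..<n}\<close>.\<close>
    have iff: "(\<Phi> a \<circ> \<beta>) (f i) \<noteq> (\<beta> \<circ> \<Phi> a) (f i) \<longleftrightarrow> i \<in> breaks n a" if "i < n" for i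
      using that n ai by (simp add: \<beta>_f \<Phi>_f inj breaks_def)
    have "{x \<in> {1..n}. (\<Phi> a \<circ> \<beta>) x \<noteq> (\<beta> \<circ> \<Phi> a) x} = f ` breaks n a" (is "?L = _")
    proof (intro equalityI subsetI)
      fix x assume x: "x \<in> ?L"
      then obtain i where "i < n" "x = f i"
        using bij_betw_imp_surj_on[OF f] by blast
      then show "x \<in> f ` breaks n a" using iff x by blast
    next
      fix x assume "x \<in> f ` breaks n a"
      then obtain i where "i \<in> breaks n a" "x = f i" by blast
      then show "x \<in> ?L" using iff f_in breaks_subset by blast
    qed
    moreover have "inj_on f (breaks n a)"
      using inj_on_subset[OF bij_betw_imp_inj_on[OF f] breaks_subset] .
    ultimately show ?thesis by (simp add: hamming_def card_image)
  qed
  have "{\<alpha>. \<alpha> permutes {1..n} \<and> hamming n (\<alpha> \<circ> \<beta>) (\<beta> \<circ> \<alpha>) \<le> k}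
      = \<Phi> ` {a. a permutes {..<n} \<and> card (breaks n a) \<le> k}" (is "?L = \<Phi> ` ?R")
  proof (intro equalityI subsetI)
    fix \<alpha> assume \<alpha>: "\<alpha> \<in> ?L"
    then obtain a where "a permutes {..<n}" "\<alpha> = \<Phi> a"
      using \<Phi> by (auto simp: bij_betw_def)
    then show "\<alpha> \<in> \<Phi> ` ?R" using ham \<alpha> by auto
  next
    fix \<alpha> assume "\<alpha> \<in> \<Phi> ` ?R"
    then show "\<alpha> \<in> ?L" using ham \<Phi> by (auto simp: bij_betw_def)
  qed
  moreover have "inj_on \<Phi> ?R"
    using \<Phi> by (auto simp: bij_betw_def inj_on_def)
  ultimately show ?thesis by (simp add: c_le_def card_image)
qed

section \<open>Rotations as the permutations without breaks\<close>

lemma rot_0 [simp]: "rot n 0 = id"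
  by (auto simp: rot_def)

lemma rot_less [simp]: "i < n \<Longrightarrow> rot n j i < n"
  by (simp add: rot_def)

lemma rot_rot: "rot n j (rot n l i) = rot n (j + l) i"
  by (simp add: rot_def mod_simps ac_simps)

lemma rot_full [simp]: "rot n n = id"
  by (auto simp: rot_def)

lemma rot_permutes:
  assumes "j \<le> n"
  shows "rot n j permutes {..<n}"
proof (rule bij_imp_permutes)
  show "bij_betw (rot n j) {..<n} {..<n}"
    by (rule bij_betw_byWitness[where f' = "rot n (n - j)"]) (use assms in \<open>auto simp: rot_rot\<close>)
qed (simp add: rot_def)

lemma rot_Suc_mod: "i < n \<Longrightarrow> rot n j (Suc i mod n) = Suc (rot n j i) mod n"
  by (simp add: rot_def mod_simps)

text \<open>A rotation commutes with the shift, so composing with it on the left changes both sides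
  of the break condition alike, and injectivity cancels it.\<close>

lemma breaks_rot_comp:
  assumes a: "a permutes {..<n}" and j: "j \<le> n"
  shows "breaks n (rot n j \<circ> a) = breaks n a"
proof -
  have "rot n j (a (Suc i mod n)) = Suc (rot n j (a i)) mod n
      \<longleftrightarrow> a (Suc i mod n) = Suc (a i) mod n" if "i < n" for i
  proof -
    have "a i < n" using permutes_in_image[OF a, of i] that by simp
    then have "Suc (rot n j (a i)) mod n = rot n j (Suc (a i) mod n)"
      by (simp add: rot_Suc_mod)
    then show ?thesis
      using permutes_inj[OF rot_permutes[OF j]] by (simp add: inj_eq)
  qed
  then show ?thesis by (auto simp: breaks_def)
qed

lemma rot_comp_in_perms_breaking_in:
  assumes "a \<in> perms_breaking_in n S" "j \<le> n"
  shows "rot n j \<circ> a \<in> perms_breaking_in n S"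
  using assms by (simp add: perms_breaking_in_def breaks_rot_comp permutes_compose rot_permutes)

lemma perms_breaking_in_empty:
  assumes n: "n \<ge> 1"
  shows "perms_breaking_in n {} = rot n ` {..<n}"
proof (intro equalityI subsetI)
  fix a assume "a \<in> perms_breaking_in n {}"
  then have a: "a permutes {..<n}" and br: "\<And>i. i < n \<Longrightarrow> a (Suc i mod n) = Suc (a i) mod n"
    by (auto simp: perms_breaking_in_def breaks_def)
  have a0: "a 0 < n" using permutes_in_image[OF a, of 0] n by simp
  have eq: "a i = (i + a 0) mod n" if "i < n" for i
    using that
  proof (induction i)
    case 0
    then show ?case using a0 by simp
  next
    case (Suc i)
    then have "a (Suc i) = Suc ((i + a 0) mod n) mod n" using br[of i] by simp
    then show ?case by (simp add: mod_Suc_eq)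
  qed
  have "a i = rot n (a 0) i" for i
    using eq[of i] permutes_not_in[OF a, of i] by (cases "i < n") (simp_all add: rot_def)
  then have "a = rot n (a 0)" by blast
  then show "a \<in> rot n ` {..<n}" using a0 by blast
next
  fix a assume "a \<in> rot n ` {..<n}"
  then obtain j where j: "j < n" "a = rot n j" by blast
  then show "a \<in> perms_breaking_in n {}"
    by (auto simp: perms_breaking_in_def breaks_def rot_permutes rot_Suc_mod)
qed

lemma inj_on_rot:
  assumes "x < n"
  shows "inj_on (\<lambda>j. rot n j x) {..<n}"
proof -
  have "inj_on (rot n x) {..<n}"
    using permutes_inj_on[OF rot_permutes] assms by simp
  \<comment> \<open>Addition is commutative, so evaluation at \<open>x\<close>, as a function of the
    amount \<open>j\<close>, is itself the rotation by \<open>x\<close>.\<close>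
  moreover have "rot n j x = rot n x j" if "j < n" for j
    using that assms by (simp add: rot_def add.commute)
  ultimately show ?thesis by (simp add: inj_on_def)
qed

lemma card_perms_breaking_in_empty:
  assumes n: "n \<ge> 1"
  shows "card (perms_breaking_in n {}) = n"
proof -
  have "inj_on (rot n) {..<n}"
    using inj_on_rot[of 0 n] n by (auto simp: inj_on_def)
  then show ?thesis using perms_breaking_in_empty[OF n] by (simp add: card_image)
qed

section \<open>Permutations whose breaks lie in a given set\<close>

text \<open>At the largest value \<open>v\<close> with different preimages \<open>x\<close> under \<open>a\<close> and \<open>y\<close> under \<open>b\<close>, both
  \<open>x\<close> and \<open>y\<close> must be block ends, and \<open>a\<close> and \<open>b\<close> order them differently. Placing the value
  \<open>n - 1\<close> at a point of \<open>S\<close> ensures that no block wraps around.\<close>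

lemma perms_breaking_in_eqI:
  assumes a: "a \<in> perms_breaking_in n S" and b: "b \<in> perms_breaking_in n S"
    and s0: "s0 \<in> S" and top: "a s0 = n - 1" "b s0 = n - 1"
    and ord: "\<And>s t. s \<in> S \<Longrightarrow> t \<in> S \<Longrightarrow> a s < a t \<longleftrightarrow> b s < b t"
  shows "a = b"
proof (rule ccontr)
  assume "a \<noteq> b"
  have pa: "a permutes {..<n}" and pb: "b permutes {..<n}"
    using a b by (auto simp: perms_breaking_in_def)
  \<comment> \<open>The value \<open>n - 1\<close> is taken at \<open>s0\<close>, hence not outside
    \<open>S\<close>, so there the reduction modulo \<open>n\<close> has no effect.\<close>
  have step: "c (Suc x mod n) = Suc (c x)"
    if "c \<in> perms_breaking_in n S" "c s0 = n - 1" "x < n" "x \<notin> S" for c x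
  proof -
    have pc: "c permutes {..<n}" using that by (simp add: perms_breaking_in_def)
    have "c x < n" using permutes_in_image[OF pc, of x] that by simp
    moreover have "c x \<noteq> n - 1"
      using permutes_inj[OF pc] that s0 by (metis injD)
    ultimately have "Suc (c x) < n" by linarith
    moreover have "c (Suc x mod n) = Suc (c x) mod n"
      using that by (auto simp: perms_breaking_in_def breaks_def)
    ultimately show ?thesis by simp
  qed
  define D where "D = {v. v < n \<and> inv a v \<noteq> inv b v}"
  have "D \<noteq> {}"
  proof
    assume "D = {}"
    then have "inv a v = inv b v" for v
      using permutes_not_in[OF permutes_inv[OF pa], of v] permutes_not_in[OF permutes_inv[OF pb], of v]
      by (cases "v < n") (auto simp: D_def)
    then have "inv a = inv b" by blast
    then show False using \<open>a \<noteq> b\<close> pa pb by (metis permutes_inv_inv)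
  qed
  have "finite D" by (simp add: D_def)
  define v where "v = Max D"
  have vD: "v \<in> D" using \<open>D \<noteq> {}\<close> \<open>finite D\<close> by (simp add: v_def)
  have above: "inv a w = inv b w" if "v < w" for w
  proof (cases "w < n")
    case True
    have "w \<notin> D" using that Max_ge[OF \<open>finite D\<close>, of w] by (auto simp: v_def)
    then show ?thesis using True by (simp add: D_def)
  next
    case False
    then show ?thesis
      using permutes_not_in[OF permutes_inv[OF pa], of w] permutes_not_in[OF permutes_inv[OF pb], of w]
      by simp
  qed
  define x y where "x = inv a v" and "y = inv b v"
  have xy: "x \<noteq> y" "v < n" using vD by (auto simp: D_def x_def y_def)
  have ax: "a x = v" and b_y: "b y = v"
    using permutes_inverses[OF pa] permutes_inverses[OF pb] by (auto simp: x_def y_def)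
  have xn: "x < n" using permutes_in_image[OF pa, of x] ax xy by simp
  have yn: "y < n" using permutes_in_image[OF pb, of y] b_y xy by simp
  have agree: "a z = b z" if "v < a z \<or> v < b z" for z
    using that above permutes_inverses[OF pa] permutes_inverses[OF pb] by metis
  \<comment> \<open>Otherwise \<open>a\<close> sends the successor of \<open>x\<close> to
    \<open>v + 1\<close>, where \<open>a\<close> and \<open>b\<close> agree; stepping back under
    \<open>b\<close> gives \<open>b x = v\<close>, hence \<open>x = y\<close>.\<close>
  have "x \<in> S"
  proof (rule ccontr)
    assume "x \<notin> S"
    then have "a (Suc x mod n) = Suc v" "b (Suc x mod n) = Suc (b x)"
      using step[OF a top(1) xn] step[OF b top(2) xn] ax by auto
    with agree[of "Suc x mod n"] have "b x = v" by simp
    then show False using xy b_y permutes_inj[OF pb] by (metis injD)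
  qed
  moreover have "y \<in> S"
  proof (rule ccontr)
    assume "y \<notin> S"
    then have "b (Suc y mod n) = Suc v" "a (Suc y mod n) = Suc (a y)"
      using step[OF a top(1) yn] step[OF b top(2) yn] b_y by auto
    with agree[of "Suc y mod n"] have "a y = v" by simp
    then show False using xy ax permutes_inj[OF pa] by (metis injD)
  qed
  \<comment> \<open>Values above \<open>v\<close> have the same preimage under both maps; as
    \<open>b y = v\<close>, also \<open>a y\<close> cannot exceed \<open>v\<close>.\<close>
  moreover have "a y < a x"
  proof -
    have "a y \<noteq> a x" using xy permutes_inj[OF pa] by (metis injD)
    moreover have "\<not> v < a y" using agree[of y] b_y by auto
    ultimately show ?thesis using ax by simp
  qed
  moreover have "b x < b y"
  proof -
    have "b y \<noteq> b x" using xy permutes_inj[OF pb] by (metis injD)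
    moreover have "\<not> v < b x" using agree[of x] ax by auto
    ultimately show ?thesis using b_y by simp
  qed
  ultimately show False using ord[of y x] by simp
qed

text \<open>For an injective key, the positions in the sorted list decide every comparison, and both
  keys produce the same list.\<close>

lemma less_iff_of_sort_key_eq:
  fixes f g :: "'a \<Rightarrow> 'b::linorder"
  assumes eq: "sort_key f xs = sort_key g xs"
    and inj: "inj_on f (set xs)" "inj_on g (set xs)"
    and st: "s \<in> set xs" "t \<in> set xs"
  shows "f s < f t \<longleftrightarrow> g s < g t"
proof -
  define L where "L = sort_key f xs"
  have L: "sorted (map f L)" "sorted (map g L)" "set L = set xs"
    using eq by (simp_all add: L_def) (metis sorted_sort_key)
  obtain i j where ij: "i < length L" "s = L ! i" "j < length L" "t = L ! j"
    using st L(3) by (metis in_set_conv_nth)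
  have key: "h s < h t \<longleftrightarrow> s \<noteq> t \<and> i < j"
    if "sorted (map h L)" "inj_on h (set xs)" for h :: "'a \<Rightarrow> 'b"
  proof (cases "s = t")
    case False
    then have "h s \<noteq> h t" using that(2) st by (auto simp: inj_on_def)
    moreover have "i \<le> j \<Longrightarrow> h s \<le> h t" "j \<le> i \<Longrightarrow> h t \<le> h s"
      using sorted_nth_mono[OF that(1)] ij by auto
    moreover have "i \<noteq> j" using False ij by auto
    ultimately show ?thesis using False by (metis leD le_neq_trans linorder_le_less_linear nat_less_le)
  qed simp
  show ?thesis using key[OF L(1) inj(1)] key[OF L(2) inj(2)] by simp
qed

text \<open>A rotation brings the value at a chosen \<open>s0\<close> to \<open>n - 1\<close>, which
  accounts for the factor \<open>n\<close>. A permutation normalised in this way is encoded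
  injectively by listing the other points of \<open>S\<close> by increasing value.\<close>

lemma card_perms_breaking_in_le:
  assumes S: "S \<subseteq> {..<n}" "S \<noteq> {}"
  shows "card (perms_breaking_in n S) \<le> n * fact (card S - 1)"
proof -
  obtain s0 where s0: "s0 \<in> S" using S by blast
  then have s0n: "s0 < n" using S by auto
  define T where "T = S - {s0}"
  have finT: "finite T" using S finite_subset by (auto simp: T_def)
  have cardT: "card T = card S - 1" using s0 by (simp add: T_def)
  define A where "A = {a \<in> perms_breaking_in n S. a s0 = n - 1}"
  define order where "order a = sort_key a (sorted_list_of_set T)" for a :: "nat \<Rightarrow> nat"
  have "inj_on order A"
  proof (rule inj_onI)
    fix a b assume A: "a \<in> A" "b \<in> A" and eq: "order a = order b"
    then have ab: "a \<in> perms_breaking_in n S" "b \<in> perms_breaking_in n S"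
      and top: "a s0 = n - 1" "b s0 = n - 1" by (auto simp: A_def)
    have inj: "inj a" "inj b"
      using ab by (auto simp: perms_breaking_in_def permutes_inj)
    have below: "s \<in> T \<Longrightarrow> c s < c s0" if "c \<in> A" for c s
    proof -
      assume s: "s \<in> T"
      have pc: "c permutes {..<n}" and c0: "c s0 = n - 1"
        using that by (auto simp: A_def perms_breaking_in_def)
      have "c s < n" using permutes_in_image[OF pc, of s] s S by (auto simp: T_def)
      moreover have "c s \<noteq> c s0" using permutes_inj[OF pc] s by (auto simp: T_def inj_eq)
      ultimately show ?thesis using c0 by linarith
    qed
    have "a s < a t \<longleftrightarrow> b s < b t" if st: "s \<in> S" "t \<in> S" for s t
    proof -
      \<comment> \<open>The value at \<open>s0\<close> is the largest for both maps, so only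
        comparisons within \<open>T\<close> need the common list.\<close>
      consider "s \<in> T" "t \<in> T" | "s = s0" "t \<in> T" | "s \<in> T" "t = s0" | "s = s0" "t = s0"
        using st by (auto simp: T_def)
      then show ?thesis
      proof cases
        case 1
        then show ?thesis
          by (intro less_iff_of_sort_key_eq[OF eq[unfolded order_def]
                inj_on_subset[OF inj(1) subset_UNIV] inj_on_subset[OF inj(2) subset_UNIV]])
            (simp_all add: finT)
      next
        case 2
        then show ?thesis using below[OF A(1)] below[OF A(2)] by (metis order_less_asym)
      next
        case 3
        then show ?thesis using below[OF A(1)] below[OF A(2)] by simp
      qed simp
    qed
    then show "a = b" using perms_breaking_in_eqI[OF ab s0 top] by blast
  qed
  moreover have "order ` A \<subseteq> permutations_of_set T"
    using finT by (auto simp: order_def permutations_of_set_def)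
  ultimately have cardA: "card A \<le> fact (card S - 1)"
    using card_inj_on_le[of order A "permutations_of_set T"] finT cardT by simp
  have "perms_breaking_in n S \<subseteq> (\<lambda>(j, a). rot n j \<circ> a) ` ({1..n} \<times> A)"
  proof
    fix a assume a: "a \<in> perms_breaking_in n S"
    have pa: "a permutes {..<n}" using a by (simp add: perms_breaking_in_def)
    have an: "a s0 < n" using permutes_in_image[OF pa, of s0] s0n by simp
    \<comment> \<open>Chosen so that \<open>a s0 + (n - j) = n - 1\<close>.\<close>
    define j where "j = Suc (a s0)"
    define b where "b = rot n (n - j) \<circ> a"
    have j: "j \<in> {1..n}" using an by (simp add: j_def)
    have "b \<in> perms_breaking_in n S"
      unfolding b_def by (rule rot_comp_in_perms_breaking_in[OF a]) simp
    moreover have "b s0 = n - 1" using an by (simp add: b_def rot_def j_def)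
    ultimately have "b \<in> A" by (simp add: A_def)
    moreover have "a = rot n j \<circ> b" using j by (auto simp: b_def rot_rot)
    ultimately show "a \<in> (\<lambda>(j, a). rot n j \<circ> a) ` ({1..n} \<times> A)" using j by force
  qed
  then have "card (perms_breaking_in n S) \<le> card ({1..n} \<times> A)"
    by (rule surj_card_le[rotated]) (simp add: A_def)
  also have "\<dots> \<le> n * fact (card S - 1)" using cardA by (simp add: card_cartesian_product)
  finally show ?thesis .
qed

section \<open>The union bound over break sets\<close>

lemma card_breaks_le_bound:
  assumes n: "n \<ge> 1" and k: "1 \<le> k" "k \<le> n"
  shows "card {a. a permutes {..<n} \<and> card (breaks n a) \<le> k}
       \<le> n + (n choose k) * (n * fact (k - 1) - n)"
proof -
  define F where "F = {S. S \<subseteq> {..<n} \<and> card S = k}"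
  have finF: "finite F" by (simp add: F_def)
  have cardF: "card F = n choose k" using n_subsets[of "{..<n}" k] by (simp add: F_def)
  define E where "E = perms_breaking_in n {}"
  have "{a. a permutes {..<n} \<and> card (breaks n a) \<le> k}
      \<subseteq> E \<union> (\<Union>S\<in>F. perms_breaking_in n S - E)"
  proof
    fix a assume "a \<in> {a. a permutes {..<n} \<and> card (breaks n a) \<le> k}"
    then have a: "a permutes {..<n}" "card (breaks n a) \<le> k" by auto
    \<comment> \<open>As \<open>k \<le> n\<close>, the break set can be enlarged to exactly
      \<open>k\<close> points.\<close>
    obtain S where "breaks n a \<subseteq> S" "S \<subseteq> {..<n}" "card S = k"
      using exists_subset_between[OF a(2), of "{..<n}"] k breaks_subset by auto
    then show "a \<in> E \<union> (\<Union>S\<in>F. perms_breaking_in n S - E)"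
      using a by (auto simp: F_def perms_breaking_in_def)
  qed
  then have "card {a. a permutes {..<n} \<and> card (breaks n a) \<le> k}
      \<le> card (E \<union> (\<Union>S\<in>F. perms_breaking_in n S - E))"
    by (rule card_mono[rotated]) (simp add: E_def finF)
  also have "\<dots> \<le> card E + card (\<Union>S\<in>F. perms_breaking_in n S - E)"
    by (rule card_Un_le)
  also have "card (\<Union>S\<in>F. perms_breaking_in n S - E) \<le> (\<Sum>S\<in>F. card (perms_breaking_in n S - E))"
    by (rule card_UN_le[OF finF])
  also have "\<dots> \<le> (\<Sum>S\<in>F. n * fact (k - 1) - n)"
  proof (rule sum_mono)
    fix S assume "S \<in> F"
    then have S: "S \<subseteq> {..<n}" "S \<noteq> {}" "card S = k" using k by (auto simp: F_def)
    have "E \<subseteq> perms_breaking_in n S" by (auto simp: E_def perms_breaking_in_def)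
    then have "card (perms_breaking_in n S - E) = card (perms_breaking_in n S) - n"
      using card_perms_breaking_in_empty[OF n] by (simp add: card_Diff_subset E_def)
    then show "card (perms_breaking_in n S - E) \<le> n * fact (k - 1) - n"
      using card_perms_breaking_in_le[OF S(1,2)] S(3) by simp
  qed
  finally show ?thesis using card_perms_breaking_in_empty[OF n] cardF by (simp add: E_def)
qed

section \<open>Sharpness for three breaks\<close>

lemma ex_perm_breaks_eq:
  assumes abc: "a < b" "b < c" "c < n"
  shows "\<exists>\<pi>. \<pi> permutes {..<n} \<and> breaks n \<pi> = {a, b, c}"
proof -
  \<comment> \<open>\<open>swap b\<close> exchanges the blocks \<open>{a<..b}\<close> and \<open>{b<..c}\<close>; its inverse is \<open>swap m\<close>.\<close>
  define swap :: "nat \<Rightarrow> nat \<Rightarrow> nat" where "swap m i = (if a < i \<and> i \<le> m then i + (c - m)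
    else if m < i \<and> i \<le> c then i - (m - a) else i)" for m i
  \<comment> \<open>After the exchange the block of length \<open>c - b\<close> comes first and ends
    at \<open>m\<close>.\<close>
  define m where "m = a + (c - b)"
  have p: "swap b permutes {..<n}"
  proof (rule bij_imp_permutes)
    show "bij_betw (swap b) {..<n} {..<n}"
      by (rule bij_betw_byWitness[where f' = "swap m"])
        (use abc in \<open>auto simp: swap_def m_def\<close>)
  qed (use abc in \<open>auto simp: swap_def\<close>)
  have "i \<in> breaks n (swap b) \<longleftrightarrow> i \<in> {a, b, c}" for i
  proof (cases "Suc i < n")
    case True
    have "swap b i < n" using permutes_in_image[OF p, of i] True by simp
    \<comment> \<open>Wrapping can occur even when \<open>Suc i < n\<close>: for
      \<open>i = b\<close> and \<open>c = n - 1\<close> the value is \<open>n - 1\<close>.\<close>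
    then have "Suc (swap b i) mod n = (if Suc (swap b i) = n then 0 else Suc (swap b i))"
      by auto
    then have "i \<in> breaks n (swap b)
        \<longleftrightarrow> swap b (Suc i) \<noteq> (if Suc (swap b i) = n then 0 else Suc (swap b i))"
      using True by (simp add: breaks_def)
    also have "\<dots> \<longleftrightarrow> i \<in> {a, b, c}"
    proof -
      \<comment> \<open>Inside each piece \<open>swap b\<close> is a translation and keeps
        successors; only the ends \<open>a\<close>, \<open>b\<close>, \<open>c\<close> of the pieces
        fail.\<close>
      consider "i < a" | "i = a" | "a < i" "i < b" | "i = b" | "b < i" "i < c" | "i = c" | "c < i"
        by linarith
      then show ?thesis using True abc by cases (simp_all add: swap_def, arith+)
    qed
    finally show ?thesis .
  next
    case False
    show ?thesis
    proof (cases "Suc i = n")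
      case True
      \<comment> \<open>The next position is 0, which is fixed, so the last position breaks exactly
        when its own value is moved, that is, when it is \<open>c\<close>.\<close>
      have "i \<in> breaks n (swap b) \<longleftrightarrow> Suc (swap b i) mod n \<noteq> 0"
        using True abc by (auto simp: breaks_def swap_def)
      moreover have "swap b i = (if i = c then c - (b - a) else i)"
        using True abc by (auto simp: swap_def)
      ultimately show ?thesis using True abc by auto
    next
      case False
      then show ?thesis using \<open>\<not> Suc i < n\<close> abc by (auto simp: breaks_def)
    qed
  qed
  then show ?thesis using p by blast
qed

lemma card_eq_3_obtain_less:
  fixes S :: "'a::linorder set"
  assumes "card S = 3"
  obtains a b c where "a < b" "b < c" "S = {a, b, c}"
proof -
  have fin: "finite S" using assms card.infinite by fastforce
  define L where "L = sorted_list_of_set S"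
  have "length L = 3" using assms by (simp add: L_def)
  then obtain a b c where "L = [a, b, c]"
    by (auto simp: numeral_3_eq_3 length_Suc_conv)
  moreover have "sorted_wrt (<) L" "set L = S" using fin by (auto simp: L_def)
  ultimately show ?thesis using that by auto
qed

text \<open>Classes with different exact break sets are disjoint. The empty set contributes the
  \<open>n\<close> rotations, and each set of three points at least the \<open>n\<close> rotated
  copies of one block exchange.\<close>

lemma card_breaks_le_3_ge:
  assumes n: "n \<ge> 1"
  shows "card {a. a permutes {..<n} \<and> card (breaks n a) \<le> 3} \<ge> n + (n choose 3) * n"
proof -
  define F where "F = {S. S \<subseteq> {..<n} \<and> card S = 3}"
  have finF: "finite F" by (simp add: F_def)
  have cardF: "card F = n choose 3" using n_subsets[of "{..<n}" 3] by (simp add: F_def)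
  define P where "P S = {a. a permutes {..<n} \<and> breaks n a = S}" for S
  have fin: "finite (P S)" for S
    using finite_perms_breaking_in by (rule rev_finite_subset) (auto simp: P_def perms_breaking_in_def)
  have P: "n \<le> card (P S)" if "S \<in> F" for S
  proof -
    have "card S = 3" using that by (simp add: F_def)
    then obtain a b c where abc: "a < b" "b < c" "S = {a, b, c}"
      by (rule card_eq_3_obtain_less)
    moreover have "c < n" using that abc by (simp add: F_def)
    ultimately obtain \<pi> where \<pi>: "\<pi> permutes {..<n}" "breaks n \<pi> = S"
      using ex_perm_breaks_eq by blast
    have "inj_on (\<lambda>j. rot n j \<circ> \<pi>) {..<n}"
    proof (rule inj_onI)
      fix j l assume jl: "j \<in> {..<n}" "l \<in> {..<n}" "rot n j \<circ> \<pi> = rot n l \<circ> \<pi>"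
      \<comment> \<open>Different rotations already differ at the single point
        \<open>\<pi> 0\<close>.\<close>
      then have "rot n j (\<pi> 0) = rot n l (\<pi> 0)" by (metis comp_apply)
      moreover have "\<pi> 0 < n" using permutes_in_image[OF \<pi>(1), of 0] n by simp
      ultimately show "j = l" using inj_onD[OF inj_on_rot] jl(1,2) by blast
    qed
    moreover have "(\<lambda>j. rot n j \<circ> \<pi>) ` {..<n} \<subseteq> P S"
      using \<pi> by (auto simp: P_def breaks_rot_comp permutes_compose rot_permutes)
    ultimately show ?thesis using card_inj_on_le[OF _ _ fin] by fastforce
  qed
  have "n + (n choose 3) * n \<le> card (P {}) + (\<Sum>S\<in>F. card (P S))"
    using card_perms_breaking_in_empty[OF n] sum_mono[of F "\<lambda>_. n", OF P] cardF
    by (simp add: P_def perms_breaking_in_def)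
  also have "(\<Sum>S\<in>F. card (P S)) = card (\<Union>S\<in>F. P S)"
    using finF fin by (intro card_UN_disjoint[symmetric]) (auto simp: P_def)
  also have "card (P {}) + \<dots> = card (P {} \<union> (\<Union>S\<in>F. P S))"
    using finF fin by (intro card_Un_disjoint[symmetric]) (auto simp: P_def F_def)
  also have "\<dots> \<le> card {a. a permutes {..<n} \<and> card (breaks n a) \<le> 3}"
    by (rule card_mono, rule rev_finite_subset[OF finite_permutations[of "{..<n}"]])
      (auto simp: P_def F_def)
  finally show ?thesis .
qed

section \<open>Comparison with the closed formula, and the cases of equality\<close>

theorem theorem3p8:
  fixes n k :: nat and \<beta> :: "nat \<Rightarrow> nat"
  assumes "n_cycle n \<beta>" and "k \<le> n"
  shows "int (c_le n k \<beta>)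
           \<le> int n * int (n choose k) * int (fact_pred k) - int n * int (n choose k) + int n
       \<and> (k \<le> 3 \<or> k = n \<longrightarrow>
           int (c_le n k \<beta>)
             = int n * int (n choose k) * int (fact_pred k) - int n * int (n choose k) + int n)"
proof -
  have n: "n \<ge> 1" using assms by (simp add: n_cycle_def)
  define C where "C = {a. a permutes {..<n} \<and> card (breaks n a) \<le> k}"
  have c: "c_le n k \<beta> = card C"
    using c_le_eq_card_breaks[OF assms(1)] by (simp add: C_def)
  define R where "R = int n * int (n choose k) * int (fact_pred k) - int n * int (n choose k) + int n"
  have E: "perms_breaking_in n {} = {a. a permutes {..<n} \<and> card (breaks n a) \<le> 0}"
    by (auto simp: perms_breaking_in_def)
  have "finite C"
    using finite_permutations[of "{..<n}"] by (rule rev_finite_subset) (auto simp: C_def)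
  moreover have "perms_breaking_in n {} \<subseteq> C" unfolding E by (auto simp: C_def)
  ultimately have ge: "n \<le> card C"
    using card_mono card_perms_breaking_in_empty[OF n] by metis
  have le: "int (card C) \<le> R"
  proof (cases "k = 0")
    case True
    then show ?thesis
      using card_perms_breaking_in_empty[OF n] E by (simp add: C_def R_def fact_pred_def)
  next
    case False
    have "int (card C) \<le> int (n + (n choose k) * (n * fact (k - 1) - n))"
      using card_breaks_le_bound[OF n _ assms(2)] False unfolding C_def of_nat_le_iff by simp
    also have "n * fact (k - 1) - n = n * (fact (k - 1) - 1)"
      by (simp add: diff_mult_distrib2)
    \<comment> \<open>Since \<open>fact (k - 1)\<close> is at least 1, the natural subtraction is
      not truncated and agrees with the one in the integers.\<close>
    also have "int (n + (n choose k) * (n * (fact (k - 1) - 1)))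
        = int n + int (n choose k) * (int n * (int (fact (k - 1)) - 1))"
      by (simp add: of_nat_diff)
    also have "\<dots> = R"
      using False by (simp add: R_def fact_pred_def algebra_simps)
    finally show ?thesis .
  qed
  have eq: "R \<le> int (card C)" if k: "k \<le> 3 \<or> k = n"
  proof -
    consider "k = 0" | "k = 1" | "k = 2" | "k = 3" | "k = n" using k by linarith
    then show ?thesis
    proof cases
      case 4
      have "fact_pred 3 = 2" by (simp add: fact_pred_def)
      then have "R = int (n + (n choose 3) * n)"
        using 4 by (simp add: R_def algebra_simps)
      then show ?thesis using card_breaks_le_3_ge[OF n] 4 by (simp only: C_def of_nat_le_iff)
    next
      case 5
      \<comment> \<open>There are only \<open>n\<close> positions, so every permutation has at most
        \<open>n\<close> breaks.\<close>
      have "C = {a. a permutes {..<n}}"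
        using card_mono[OF _ breaks_subset] 5 by (auto simp: C_def)
      then have "card C = fact n" by (simp add: card_permutations)
      also have "\<dots> = n * fact (n - 1)" using n by (simp add: fact_reduce)
      finally show ?thesis using 5 n by (simp add: R_def fact_pred_def)
    \<comment> \<open>For \<open>k \<le> 2\<close> the value \<open>fact_pred k\<close> is 1, so
      \<open>R\<close> collapses to \<open>n\<close>, which the rotations attain.\<close>
    qed (use ge in \<open>simp_all add: R_def fact_pred_def\<close>)
  qed
  show ?thesis using c le eq by (auto simp: R_def)
qed

end
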